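(* Suppose $L$ is a cyclically transitive linear order that is not bounded. Given an ordinal $\gamma$, if the Hausdorff condensation $\mathbf{c}_f^\beta(L)$ is not bounded for each $\beta<\gamma$, then $\mathbf{c}_f^\gamma(L)$ is cyclically transitive.
   Context: A linear order is bounded if it has both a least element and a greatest element (so "not bounded" means that at least one of these is missing). $L_1+L_2$ denotes the ordered sum (every element of $L_1$ strictly below every element of $L_2$); a partition $L=L_1+L_2$ means that $L_1$ is an initial segment of $L$ and $L_2$ is its complement (either may be empty). $L$ is cyclically transitive if for any $a\le b$ in $L$ there exist partitions $L=L_1+L_2=L_2'+L_1'$ with $a\in L_1$, $b\in L_1'$, and order isomorphisms $F_1:L_1\to L_1'$, $F_2:L_2\to L_2'$ satisfying $F_1(a)=b$. For $a,b\in L$ let $[a,b]:=\{c\in L\mid a\le c\le b\}\cup\{c\in L\mid b\le c\le a\}$. Equivalence relations $\sim_\gamma$ on $L$, for ordinals $\gamma$, are defined by transfinite recursion: $a\sim_0 b$ iff $a=b$; $a\sim_{\beta+1}b$ iff $[a,b]$ intersects only finitely many $\sim_\beta$-equivalence classes; for a limit ordinal $\gamma$, $a\sim_\gamma b$ iff $a\sim_\beta b$ for some $\beta<\gamma$. The $\sim_\gamma$-classes are convex, and the $\gamma$-th Hausdorff condensation $\mathbf{c}_f^\gamma(L):=L/\sim_\gamma$ is the set of classes with the induced linear order. *)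

theory Defs
  imports Main
begin

text \<open>
  A linear order \<open>L\<close> is a reflexive relation \<open>r\<close> with \<open>Linear_order r\<close>; its carrier is
  \<open>Field r\<close>, possibly empty. The relational form is used because \<open>L\<close> and its
  condensations, whose points are sets, have to be handled by the same notions.
\<close>

definition bounded_order :: "'a rel \<Rightarrow> bool" where
  "bounded_order r \<longleftrightarrow>
     (\<exists>m\<in>Field r. \<forall>x\<in>Field r. (m, x) \<in> r) \<and>
     (\<exists>m\<in>Field r. \<forall>x\<in>Field r. (x, m) \<in> r)"

text \<open>
  \<open>order_partition r A B\<close> is \<open>L = A + B\<close>. The library's \<open>ofilter\<close> is a downward closed
  subset of the field.
\<close>

definition order_partition :: "'a rel \<Rightarrow> 'a set \<Rightarrow> 'a set \<Rightarrow> bool" where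
  "order_partition r A B \<longleftrightarrow> ofilter r A \<and> B = Field r - A"

text \<open>
  The library's \<open>iso\<close> is defined with well-orders in mind, but by \<open>iso_iff2\<close> it says, for
  arbitrary relations, that the map is a bijection of the fields which preserves and reflects
  the relation.
\<close>

definition cyclically_transitive :: "'a rel \<Rightarrow> bool" where
  "cyclically_transitive r \<longleftrightarrow>
     (\<forall>a b. (a, b) \<in> r \<longrightarrow>
       (\<exists>L1 L2 L1' L2' F1 F2.
          order_partition r L1 L2 \<and> order_partition r L2' L1' \<and>
          a \<in> L1 \<and> b \<in> L1' \<and>
          iso (Restr r L1) (Restr r L1') F1 \<and>
          iso (Restr r L2) (Restr r L2') F2 \<and>
          F1 a = b))"

definition order_interval :: "'a rel \<Rightarrow> 'a \<Rightarrow> 'a \<Rightarrow> 'a set" where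
  "order_interval r a b =
     {c. (a, c) \<in> r \<and> (c, b) \<in> r} \<union> {c. (b, c) \<in> r \<and> (c, a) \<in> r}"

text \<open>
  An ordinal is an element of an arbitrary type of class \<open>wellorder\<close>: every ordinal arises as
  the order type of the predecessors of such an element, and recursion only looks below it.
\<close>

definition is_successor_of :: "'o::wellorder \<Rightarrow> 'o \<Rightarrow> bool" where
  "is_successor_of \<gamma> \<beta> \<longleftrightarrow> \<beta> < \<gamma> \<and> (\<forall>\<delta><\<gamma>. \<delta> \<le> \<beta>)"

lemma is_successor_of_unique:
  "is_successor_of \<gamma> \<beta> \<Longrightarrow> is_successor_of \<gamma> \<beta>' \<Longrightarrow> \<beta>' = \<beta>"
  unfolding is_successor_of_def by (meson order.antisym)

lemma The_is_successor_of: "is_successor_of \<gamma> \<beta> \<Longrightarrow> (THE \<beta>. is_successor_of \<gamma> \<beta>) = \<beta>"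
  by (blast intro: the_equality is_successor_of_unique)

function hausdorff_rel :: "'a rel \<Rightarrow> 'o::wellorder \<Rightarrow> 'a rel" where
  "hausdorff_rel r \<gamma> =
    (if \<forall>\<beta>. \<gamma> \<le> \<beta> then Id_on (Field r)
     else if \<exists>\<beta>. is_successor_of \<gamma> \<beta> then
       {(a, b) \<in> Field r \<times> Field r.
          finite {C \<in> Field r // hausdorff_rel r (THE \<beta>. is_successor_of \<gamma> \<beta>).
                    order_interval r a b \<inter> C \<noteq> {}}}
     else (\<Union>\<beta>\<in>{..<\<gamma>}. hausdorff_rel r \<beta>))"
  by auto
termination
proof (relation "inv_image {(\<beta>, \<gamma>). \<beta> < \<gamma>} snd")
  show "wf (inv_image {(\<beta>, \<gamma>::'o::wellorder). \<beta> < \<gamma>} (snd :: 'a rel \<times> 'o \<Rightarrow> 'o))"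
    by (rule wf_inv_image) (rule wf)
next
  fix r :: "'a rel" and \<gamma> :: "'o::wellorder"
  assume "\<exists>\<beta>. is_successor_of \<gamma> \<beta>"
  then show "((r, THE \<beta>. is_successor_of \<gamma> \<beta>), (r, \<gamma>)) \<in> inv_image {(\<beta>, \<gamma>). \<beta> < \<gamma>} snd"
    using The_is_successor_of is_successor_of_def by fastforce
qed simp

declare hausdorff_rel.simps [simp del]

lemma hausdorff_rel_zero:
  "(\<And>\<beta>. \<gamma> \<le> \<beta>) \<Longrightarrow> hausdorff_rel r \<gamma> = Id_on (Field r)"
  by (subst hausdorff_rel.simps) simp

lemma hausdorff_rel_successor:
  assumes "is_successor_of \<gamma> \<beta>"
  shows "hausdorff_rel r \<gamma> =
    {(a, b) \<in> Field r \<times> Field r.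
       finite {C \<in> Field r // hausdorff_rel r \<beta>. order_interval r a b \<inter> C \<noteq> {}}}"
proof -
  have "\<not> (\<forall>\<beta>. \<gamma> \<le> \<beta>)"
    using assms unfolding is_successor_of_def by (meson leD)
  moreover have "\<exists>\<beta>. is_successor_of \<gamma> \<beta>"
    using assms by blast
  ultimately show ?thesis
    by (simp only: hausdorff_rel.simps[of r \<gamma>] The_is_successor_of[OF assms] if_False if_True)
qed

lemma hausdorff_rel_limit:
  assumes "\<beta> < \<gamma>" and "\<And>\<beta>. \<not> is_successor_of \<gamma> \<beta>"
  shows "hausdorff_rel r \<gamma> = (\<Union>\<beta>\<in>{..<\<gamma>}. hausdorff_rel r \<beta>)"
proof -
  have "\<not> (\<forall>\<beta>. \<gamma> \<le> \<beta>)"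
    using assms(1) by (meson leD)
  moreover have "\<not> (\<exists>\<beta>. is_successor_of \<gamma> \<beta>)"
    using assms(2) by blast
  ultimately show ?thesis
    by (simp only: hausdorff_rel.simps[of r \<gamma>] if_False)
qed

definition hausdorff_condensation :: "'a rel \<Rightarrow> 'o::wellorder \<Rightarrow> 'a set rel" where
  "hausdorff_condensation r \<gamma> =
     {(C, D). C \<in> Field r // hausdorff_rel r \<gamma> \<and> D \<in> Field r // hausdorff_rel r \<gamma> \<and>
              (\<exists>x\<in>C. \<exists>y\<in>D. (x, y) \<in> r)}"

end

theory Submission
  imports Defs
begin

text \<open>
  An isomorphism between convex parts of \<open>L\<close> preserves every \<open>\<sim>\<^sub>\<gamma>\<close>, so the two isomorphisms
  witnessing cyclic transitivity of \<open>L\<close> descend to \<open>c\<^sup>\<gamma>(L)\<close> as soon as neither of the cuts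
  \<open>L = L\<^sub>1 + L\<^sub>2 = L\<^sub>2' + L\<^sub>1'\<close> splits a \<open>\<sim>\<^sub>\<gamma>\<close>-class. Suppose the first cut separates \<open>a \<sim>\<^sub>\<gamma> b\<close>.
  Then for some \<open>\<beta> < \<gamma>\<close> the interval \<open>[a, b]\<close> meets only finitely many \<open>\<sim>\<^sub>\<beta>\<close>-classes, so \<open>L\<^sub>1\<close> has a
  last and \<open>L\<^sub>2\<close> a first \<open>\<sim>\<^sub>\<beta>\<close>-class. Transported to \<open>L\<^sub>1'\<close> and \<open>L\<^sub>2'\<close> these become the last and
  the first point of \<open>c\<^sup>\<beta>(L)\<close>, which is therefore bounded. The second cut is handled in the same
  way with the inverse isomorphisms.
\<close>

section \<open>Intervals and convex equivalence relations\<close>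

text \<open>The invariant carried through the transfinite recursion. Convexity is phrased by
  \<open>order_interval\<close>, which does not see the direction of \<open>r\<close>, so the notion
  passes to \<open>r\<inverse>\<close> and an argument for last classes also yields first
  classes.\<close>

definition convex_equiv :: "'a rel \<Rightarrow> 'a rel \<Rightarrow> bool" where
  "convex_equiv r H \<longleftrightarrow> equiv (Field r) H \<and>
     (\<forall>a b. (a, b) \<in> H \<longrightarrow> order_interval r a b \<subseteq> H `` {a})"

lemma Linear_orderD:
  assumes "Linear_order r"
  shows "\<And>x. x \<in> Field r \<Longrightarrow> (x, x) \<in> r"
    and "\<And>x y z. (x, y) \<in> r \<Longrightarrow> (y, z) \<in> r \<Longrightarrow> (x, z) \<in> r"
    and "\<And>x y. (x, y) \<in> r \<Longrightarrow> (y, x) \<in> r \<Longrightarrow> x = y"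
    and "\<And>x y. x \<in> Field r \<Longrightarrow> y \<in> Field r \<Longrightarrow> (x, y) \<in> r \<or> (y, x) \<in> r"
proof -
  have *: "refl_on (Field r) r" "trans r" "antisym r" "total_on (Field r) r"
    using assms by (simp_all add: order_on_defs)
  show "(x, x) \<in> r" if "x \<in> Field r" for x
    using *(1) that by (rule refl_onD)
  then show "(x, y) \<in> r \<or> (y, x) \<in> r" if "x \<in> Field r" "y \<in> Field r" for x y
    using *(4) that unfolding total_on_def by metis
  show "(x, z) \<in> r" if "(x, y) \<in> r" "(y, z) \<in> r" for x y z
    using *(2) that by (rule transD)
  show "x = y" if "(x, y) \<in> r" "(y, x) \<in> r" for x y
    using *(3) that by (rule antisymD)
qed

lemma order_interval_subset_Field: "order_interval r a b \<subseteq> Field r"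
  unfolding order_interval_def by (auto intro: FieldI1 FieldI2)

lemma order_interval_commute: "order_interval r a b = order_interval r b a"
  unfolding order_interval_def by blast

lemma order_interval_converse: "order_interval (r\<inverse>) a b = order_interval r a b"
  unfolding order_interval_def by blast

lemma order_interval_eq:
  assumes "Linear_order r" "(a, b) \<in> r"
  shows "order_interval r a b = {c. (a, c) \<in> r \<and> (c, b) \<in> r}"
  using Linear_orderD(2)[OF assms(1)] Linear_orderD(3)[OF assms(1)] assms(2) unfolding order_interval_def by blast

lemma order_interval_same:
  assumes "Linear_order r"
  shows "order_interval r a a \<subseteq> {a}"
  using Linear_orderD(3)[OF assms] unfolding order_interval_def by blast

lemma order_interval_mono:
  assumes "Linear_order r" "c \<in> order_interval r a b"
  shows "order_interval r a c \<subseteq> order_interval r a b"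
  using assms(2) Linear_orderD(2,3)[OF assms(1)] unfolding order_interval_def by blast

lemma order_interval_triangle:
  assumes "Linear_order r" "a \<in> Field r" "b \<in> Field r" "c \<in> Field r"
  shows "order_interval r a c \<subseteq> order_interval r a b \<union> order_interval r b c"
proof
  fix x assume x: "x \<in> order_interval r a c"
  then have "x \<in> Field r"
    by (rule subsetD[OF order_interval_subset_Field])
  then have "(x, b) \<in> r \<or> (b, x) \<in> r"
    using Linear_orderD(4)[OF assms(1)] assms(3) by blast
  then show "x \<in> order_interval r a b \<union> order_interval r b c"
    using x unfolding order_interval_def by blast
qed

lemma convex_equivD:
  assumes "convex_equiv r H"
  shows "equiv (Field r) H"
    and "\<And>x. x \<in> Field r \<Longrightarrow> (x, x) \<in> H"
    and "\<And>x y. (x, y) \<in> H \<Longrightarrow> (y, x) \<in> H"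
    and "\<And>x y z. (x, y) \<in> H \<Longrightarrow> (y, z) \<in> H \<Longrightarrow> (x, z) \<in> H"
    and "\<And>x y. (x, y) \<in> H \<Longrightarrow> x \<in> Field r \<and> y \<in> Field r"
    and "\<And>x y z. (x, y) \<in> H \<Longrightarrow> z \<in> order_interval r x y \<Longrightarrow> (x, z) \<in> H"
proof -
  show e: "equiv (Field r) H"
    using assms unfolding convex_equiv_def by blast
  show "\<And>x. x \<in> Field r \<Longrightarrow> (x, x) \<in> H"
    using e by (meson equivE refl_onD)
  show "\<And>x y. (x, y) \<in> H \<Longrightarrow> (y, x) \<in> H"
    using e by (meson equivE symD)
  show "\<And>x y z. (x, y) \<in> H \<Longrightarrow> (y, z) \<in> H \<Longrightarrow> (x, z) \<in> H"
    using e by (meson equivE transD)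
  show "\<And>x y. (x, y) \<in> H \<Longrightarrow> x \<in> Field r \<and> y \<in> Field r"
    using equiv_class_eq_iff[OF e] by blast
  show "\<And>x y z. (x, y) \<in> H \<Longrightarrow> z \<in> order_interval r x y \<Longrightarrow> (x, z) \<in> H"
    using assms unfolding convex_equiv_def by blast
qed

lemma convex_equiv_converse: "convex_equiv (r\<inverse>) H \<longleftrightarrow> convex_equiv r H"
  by (simp add: convex_equiv_def order_interval_converse)

text \<open>The successor clause counts the classes met by an interval. As an image of the interval,
  this family is easy to compare for subintervals, unions and isomorphic copies.\<close>

lemma classes_meeting_eq_image:
  assumes "equiv A H" "S \<subseteq> A"
  shows "{C \<in> A // H. S \<inter> C \<noteq> {}} = (\<lambda>z. H `` {z}) ` S"
proof
  show "{C \<in> A // H. S \<inter> C \<noteq> {}} \<subseteq> (\<lambda>z. H `` {z}) ` S"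
  proof
    fix C assume C: "C \<in> {C \<in> A // H. S \<inter> C \<noteq> {}}"
    then obtain z where "z \<in> S" "z \<in> C" "C \<in> A // H"
      by blast
    then have "C = H `` {z}"
      using assms(1) by (metis Image_singleton_iff equiv_class_eq quotientE)
    then show "C \<in> (\<lambda>z. H `` {z}) ` S"
      using \<open>z \<in> S\<close> by blast
  qed
  show "(\<lambda>z. H `` {z}) ` S \<subseteq> {C \<in> A // H. S \<inter> C \<noteq> {}}"
    using assms equiv_class_self[OF assms(1)] by (auto intro: quotientI)
qed

text \<open>By convexity the whole interval lies in the class of \<open>a\<close>, so it meets at
  most one class.\<close>

lemma convex_equiv_finite_classes:
  assumes "convex_equiv r H" "(a, b) \<in> H"
  shows "finite ((\<lambda>z. H `` {z}) ` order_interval r a b)"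
proof (rule finite_subset)
  show "(\<lambda>z. H `` {z}) ` order_interval r a b \<subseteq> {H `` {a}}"
    using convex_equivD(6)[OF assms] equiv_class_eq[OF convex_equivD(1)[OF assms(1)]] by blast
qed simp

section \<open>The condensation relations\<close>

lemma hausdorff_rel_successor_iff:
  assumes "is_successor_of \<gamma> \<beta>" "equiv (Field r) (hausdorff_rel r \<beta>)"
  shows "(a, b) \<in> hausdorff_rel r \<gamma> \<longleftrightarrow> a \<in> Field r \<and> b \<in> Field r \<and>
           finite ((\<lambda>z. hausdorff_rel r \<beta> `` {z}) ` order_interval r a b)"
  using classes_meeting_eq_image[OF assms(2) order_interval_subset_Field, of a b]
  by (simp add: hausdorff_rel_successor[OF assms(1)])

lemma convex_equivI:
  assumes "\<And>x. x \<in> Field r \<Longrightarrow> (x, x) \<in> H"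
    and "\<And>x y. (x, y) \<in> H \<Longrightarrow> x \<in> Field r \<and> y \<in> Field r"
    and "\<And>x y. (x, y) \<in> H \<Longrightarrow> (y, x) \<in> H"
    and "\<And>x y z. (x, y) \<in> H \<Longrightarrow> (y, z) \<in> H \<Longrightarrow> (x, z) \<in> H"
    and "\<And>x y z. (x, y) \<in> H \<Longrightarrow> z \<in> order_interval r x y \<Longrightarrow> (x, z) \<in> H"
  shows "convex_equiv r H"
  unfolding convex_equiv_def
proof (intro conjI equivI)
  show "H \<subseteq> Field r \<times> Field r" "refl_on (Field r) H"
    using assms(1,2) by (auto intro!: refl_onI)
  show "sym H" "trans H"
    using assms(3,4) by (meson symI transI)+
  show "\<forall>a b. (a, b) \<in> H \<longrightarrow> order_interval r a b \<subseteq> H `` {a}"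
    using assms(5) by blast
qed

lemma wellorder_zero_successor_limit:
  fixes \<gamma> :: "'o::wellorder"
  obtains (zero) "\<And>\<beta>. \<gamma> \<le> \<beta>"
  | (successor) \<beta> where "is_successor_of \<gamma> \<beta>"
  | (limit) \<beta> where "\<beta> < \<gamma>" "\<And>\<beta>. \<not> is_successor_of \<gamma> \<beta>"
  by (meson not_le)

text \<open>The two claims share one induction. At a limit, transitivity has to combine witnesses
  from two levels, and monotonicity lifts both to the maximum. At a successor,
  \<open>?H \<beta> \<subseteq> ?H \<gamma>\<close> comes from the convexity of
  \<open>?H \<beta>\<close>.\<close>

lemma hausdorff_rel_convex_equiv_mono:
  fixes \<gamma> :: "'o::wellorder"
  assumes r: "Linear_order r"
  shows "convex_equiv r (hausdorff_rel r \<gamma>) \<and>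
         (\<forall>\<beta>\<le>\<gamma>. hausdorff_rel r \<beta> \<subseteq> hausdorff_rel r \<gamma>)"
proof (induction \<gamma> rule: less_induct)
  case (less \<gamma>)
  let ?H = "\<lambda>\<gamma>. hausdorff_rel r (\<gamma> :: 'o)"
  show ?case
  proof (cases \<gamma> rule: wellorder_zero_successor_limit)
    case zero
    have "convex_equiv r (?H \<gamma>)"
      using order_interval_same[OF r]
      by (intro convex_equivI) (auto simp: hausdorff_rel_zero[OF zero])
    moreover have "\<beta> = \<gamma>" if "\<beta> \<le> \<gamma>" for \<beta>
      using that zero by (simp add: order.antisym)
    ultimately show ?thesis
      by blast
  next
    case (successor \<beta>)
    then have "\<beta> < \<gamma>"
      by (simp add: is_successor_of_def)
    then have \<beta>: "convex_equiv r (?H \<beta>)" "\<And>\<delta>. \<delta> \<le> \<beta> \<Longrightarrow> ?H \<delta> \<subseteq> ?H \<beta>"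
      using less.IH by blast+
    note iff = hausdorff_rel_successor_iff[OF successor convex_equivD(1)[OF \<beta>(1)]]
    let ?cl = "\<lambda>z. ?H \<beta> `` {z}"
    have "convex_equiv r (?H \<gamma>)"
    proof (rule convex_equivI)
      show "(x, x) \<in> ?H \<gamma>" if "x \<in> Field r" for x
        using that finite_subset[OF order_interval_same[OF r, of x]] by (simp add: iff)
      show "x \<in> Field r \<and> y \<in> Field r" if "(x, y) \<in> ?H \<gamma>" for x y
        using that by (simp add: iff)
      show "(y, x) \<in> ?H \<gamma>" if "(x, y) \<in> ?H \<gamma>" for x y
        using that by (simp add: iff order_interval_commute)
      show "(x, z) \<in> ?H \<gamma>" if "(x, y) \<in> ?H \<gamma>" "(y, z) \<in> ?H \<gamma>" for x y z
      proof -
        \<comment> \<open>The interval from \<open>x\<close> to \<open>z\<close> is covered by those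
          from \<open>x\<close> to \<open>y\<close> and from \<open>y\<close> to \<open>z\<close>,
          each meeting finitely many classes.\<close>
        have "finite (?cl ` (order_interval r x y \<union> order_interval r y z))"
          using that by (simp add: iff image_Un)
        then have "finite (?cl ` order_interval r x z)"
          by (rule rev_finite_subset)
            (use that order_interval_triangle[OF r] in \<open>auto intro!: image_mono simp: iff\<close>)
        then show ?thesis
          using that by (simp add: iff)
      qed
      show "(x, z) \<in> ?H \<gamma>" if "(x, y) \<in> ?H \<gamma>" "z \<in> order_interval r x y" for x y z
        using that order_interval_mono[OF r that(2)] order_interval_subset_Field[of r x y]
        by (auto simp: iff intro: rev_finite_subset)
    qed
    moreover have "?H \<beta> \<subseteq> ?H \<gamma>"
      using convex_equivD(5)[OF \<beta>(1)] convex_equiv_finite_classes[OF \<beta>(1)] by (auto simp: iff)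
    \<comment> \<open>Since \<open>\<beta>\<close> is the immediate predecessor of
      \<open>\<gamma>\<close>, every smaller level is at most \<open>\<beta>\<close>, where the
      induction hypothesis gives the inclusion.\<close>
    moreover have "\<delta> = \<gamma> \<or> \<delta> \<le> \<beta>" if "\<delta> \<le> \<gamma>" for \<delta>
      using that successor unfolding is_successor_of_def by (auto simp: order.order_iff_strict)
    ultimately show ?thesis
      using \<beta>(2) by blast
  next
    case (limit \<alpha>)
    have eq: "?H \<gamma> = (\<Union>\<beta>\<in>{..<\<gamma>}. ?H \<beta>)"
      by (rule hausdorff_rel_limit[OF limit])
    have ce: "\<And>\<beta>. \<beta> < \<gamma> \<Longrightarrow> convex_equiv r (?H \<beta>)"
      using less.IH by blast
    have "convex_equiv r (?H \<gamma>)"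
    proof (rule convex_equivI)
      show "(x, x) \<in> ?H \<gamma>" if "x \<in> Field r" for x
        using that limit(1) convex_equivD(2)[OF ce[OF limit(1)]] unfolding eq by blast
      show "x \<in> Field r \<and> y \<in> Field r" if "(x, y) \<in> ?H \<gamma>" for x y
        using that convex_equivD(5)[OF ce] unfolding eq by blast
      show "(y, x) \<in> ?H \<gamma>" if "(x, y) \<in> ?H \<gamma>" for x y
        using that convex_equivD(3)[OF ce] unfolding eq by blast
      show "(x, z) \<in> ?H \<gamma>" if xyz: "(x, y) \<in> ?H \<gamma>" "(y, z) \<in> ?H \<gamma>" for x y z
      proof -
        obtain \<beta> \<delta> where bd: "\<beta> < \<gamma>" "(x, y) \<in> ?H \<beta>" "\<delta> < \<gamma>" "(y, z) \<in> ?H \<delta>"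
          using xyz unfolding eq by blast
        have "max \<beta> \<delta> < \<gamma>"
          using bd by simp
        then have "?H \<beta> \<subseteq> ?H (max \<beta> \<delta>)" "?H \<delta> \<subseteq> ?H (max \<beta> \<delta>)"
          using less.IH by simp_all
        then have "(x, z) \<in> ?H (max \<beta> \<delta>)"
          using bd convex_equivD(4)[OF ce[OF \<open>max \<beta> \<delta> < \<gamma>\<close>]] by blast
        then show ?thesis
          using \<open>max \<beta> \<delta> < \<gamma>\<close> unfolding eq by blast
      qed
      show "(x, z) \<in> ?H \<gamma>" if "(x, y) \<in> ?H \<gamma>" "z \<in> order_interval r x y" for x y z
        using that convex_equivD(6)[OF ce] unfolding eq by blast
    qed
    then show ?thesis
      unfolding eq by (auto simp: order.order_iff_strict eq)
  qed
qed

lemmas hausdorff_rel_convex_equiv = hausdorff_rel_convex_equiv_mono[THEN conjunct1]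

text \<open>Gives successors and limits a common form. At zero no two distinct points are
  equivalent; at a successor the predecessor serves; at a limit the pair is already equivalent at
  some lower level, where the interval stays inside one class.\<close>

lemma hausdorff_rel_distinctD:
  fixes \<gamma> :: "'o::wellorder"
  assumes "Linear_order r" "(a, b) \<in> hausdorff_rel r \<gamma>" "a \<noteq> b"
  obtains \<beta> where "\<beta> < \<gamma>"
    "finite ((\<lambda>z. hausdorff_rel r \<beta> `` {z}) ` order_interval r a b)"
proof (cases \<gamma> rule: wellorder_zero_successor_limit)
  case zero
  then show ?thesis
    using assms(2,3) by (simp add: hausdorff_rel_zero Id_on_iff)
next
  case (successor \<beta>)
  then have "\<beta> < \<gamma>"
    by (simp add: is_successor_of_def)
  with that show ?thesis
    using assms(2) hausdorff_rel_successor_iff[OF successor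
      convex_equivD(1)[OF hausdorff_rel_convex_equiv[OF assms(1)]]] by blast
next
  case (limit \<alpha>)
  then obtain \<beta> where "\<beta> < \<gamma>" "(a, b) \<in> hausdorff_rel r \<beta>"
    using assms(2) hausdorff_rel_limit[OF limit] by blast
  with that show ?thesis
    using convex_equiv_finite_classes[OF hausdorff_rel_convex_equiv[OF assms(1)]] by blast
qed

section \<open>Isomorphisms between convex parts\<close>

definition order_convex :: "'a rel \<Rightarrow> 'a set \<Rightarrow> bool" where
  "order_convex r A \<longleftrightarrow> A \<subseteq> Field r \<and> (\<forall>x\<in>A. \<forall>y\<in>A. order_interval r x y \<subseteq> A)"

lemma iso_Restr_iff:
  assumes "Linear_order r" "A \<subseteq> Field r" "B \<subseteq> Field r"
  shows "iso (Restr r A) (Restr r B) F \<longleftrightarrow>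
           bij_betw F A B \<and> (\<forall>x\<in>A. \<forall>y\<in>A. (x, y) \<in> r \<longleftrightarrow> (F x, F y) \<in> r)"
proof -
  \<comment> \<open>Reflexivity keeps every point of \<open>C\<close> in the field, even when
    \<open>C\<close> is a singleton.\<close>
  have F: "Field (Restr r C) = C" if "C \<subseteq> Field r" for C
    using that Linear_orderD(1)[OF assms(1)] unfolding Field_def by blast
  show ?thesis
    unfolding iso_iff2 F[OF assms(2)] F[OF assms(3)]
    by (auto dest: bij_betwE)
qed

lemma iso_Restr_inv:
  assumes "Linear_order r" "A \<subseteq> Field r" "B \<subseteq> Field r" "iso (Restr r A) (Restr r B) F"
  shows "iso (Restr r B) (Restr r A) (inv_into A F)"
proof -
  have F: "bij_betw F A B" "\<And>x y. x \<in> A \<Longrightarrow> y \<in> A \<Longrightarrow> (x, y) \<in> r \<longleftrightarrow> (F x, F y) \<in> r"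
    using assms(4) unfolding iso_Restr_iff[OF assms(1-3)] by auto
  have "bij_betw (inv_into A F) B A"
    by (rule bij_betw_inv_into[OF F(1)])
  then show ?thesis
    unfolding iso_Restr_iff[OF assms(1,3,2)]
    using F bij_betw_inv_into_right[OF F(1)] by (auto simp: bij_betw_apply)
qed

text \<open>The intervals are taken in the whole order. Convexity places them inside
  \<open>A\<close> and \<open>B\<close>, where \<open>F\<close> preserves and reflects
  \<open>r\<close>.\<close>

lemma iso_Restr_image_order_interval:
  assumes "Linear_order r" "order_convex r A" "order_convex r B"
    and iso: "iso (Restr r A) (Restr r B) F" and "x \<in> A" "y \<in> A"
  shows "F ` order_interval r x y = order_interval r (F x) (F y)"
proof -
  have AB: "A \<subseteq> Field r" "B \<subseteq> Field r"
    using assms unfolding order_convex_def by auto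
  have F: "bij_betw F A B" "\<And>x y. x \<in> A \<Longrightarrow> y \<in> A \<Longrightarrow> (x, y) \<in> r \<longleftrightarrow> (F x, F y) \<in> r"
    using iso unfolding iso_Restr_iff[OF assms(1) AB] by auto
  have sub: "order_interval r x y \<subseteq> A" "order_interval r (F x) (F y) \<subseteq> B"
    using assms F(1) unfolding order_convex_def by (auto simp: bij_betw_apply)
  have eq: "F z \<in> order_interval r (F x) (F y) \<longleftrightarrow> z \<in> order_interval r x y" if "z \<in> A" for z
    using that F(2) assms(5,6) unfolding order_interval_def by blast
  show ?thesis
  proof
    show "F ` order_interval r x y \<subseteq> order_interval r (F x) (F y)"
      using eq sub(1) by blast
    show "order_interval r (F x) (F y) \<subseteq> F ` order_interval r x y"
    proof
      fix w assume w: "w \<in> order_interval r (F x) (F y)"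
      then obtain z where "z \<in> A" "w = F z"
        using sub(2) F(1) by (metis bij_betw_imp_surj_on imageE subsetD)
      then show "w \<in> F ` order_interval r x y"
        using w eq by blast
    qed
  qed
qed

lemma finite_image_transfer:
  assumes "finite (f ` S)" "\<And>x y. x \<in> S \<Longrightarrow> y \<in> S \<Longrightarrow> f x = f y \<Longrightarrow> g x = g y"
  shows "finite (g ` S)"
proof -
  have "g ` S \<subseteq> (\<lambda>c. g (SOME x. x \<in> S \<and> f x = c)) ` f ` S"
  proof
    fix v assume "v \<in> g ` S"
    then obtain x where x: "x \<in> S" "v = g x"
      by blast
    let ?y = "SOME y. y \<in> S \<and> f y = f x"
    have "?y \<in> S \<and> f ?y = f x"
      by (rule someI[of _ x]) (use x in simp)
    then have "v = g ?y"
      using assms(2) x by metis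
    then show "v \<in> (\<lambda>c. g (SOME x. x \<in> S \<and> f x = c)) ` f ` S"
      using x(1) by blast
  qed
  then show ?thesis
    using assms(1) finite_surj by blast
qed

text \<open>The relation belongs to the whole order, but whether it holds for \<open>x\<close> and
  \<open>y\<close> is decided on the interval between them, which stays inside \<open>A\<close>. The
  points are kept arbitrary because the successor step uses the induction hypothesis for all pairs
  in that interval.\<close>

lemma hausdorff_rel_iso_Restr_iff:
  fixes \<gamma> :: "'o::wellorder"
  assumes r: "Linear_order r" and A: "order_convex r A" and B: "order_convex r B"
    and iso: "iso (Restr r A) (Restr r B) F" and "x \<in> A" "y \<in> A"
  shows "(F x, F y) \<in> hausdorff_rel r \<gamma> \<longleftrightarrow> (x, y) \<in> hausdorff_rel r \<gamma>"
  using assms(5,6)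
proof (induction \<gamma> arbitrary: x y rule: less_induct)
  case (less \<gamma>)
  have AB: "A \<subseteq> Field r" "B \<subseteq> Field r"
    using A B unfolding order_convex_def by auto
  have F: "bij_betw F A B"
    using iso unfolding iso_Restr_iff[OF r AB] by auto
  have fld: "x \<in> Field r" "y \<in> Field r" "F x \<in> Field r" "F y \<in> Field r"
    using less.prems AB F by (auto simp: bij_betw_def)
  show ?case
  proof (cases \<gamma> rule: wellorder_zero_successor_limit)
    case zero
    then show ?thesis
      using fld bij_betw_imp_inj_on[OF F] less.prems
      by (simp add: hausdorff_rel_zero Id_on_iff inj_on_eq_iff)
  next
    case (successor \<beta>)
    then have "\<beta> < \<gamma>"
      by (simp add: is_successor_of_def)
    let ?H = "hausdorff_rel r \<beta>"
    let ?I = "order_interval r x y"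
    have e: "equiv (Field r) ?H"
      by (rule convex_equivD(1)[OF hausdorff_rel_convex_equiv[OF r]])
    have I: "?I \<subseteq> A"
      using A less.prems unfolding order_convex_def by blast
    \<comment> \<open>Classes may reach beyond \<open>A\<close> and \<open>B\<close>, so
      \<open>F\<close> need not map class onto class. It is enough to know which points of the
      interval share a class.\<close>
    have cl: "?H `` {F z} = ?H `` {F w} \<longleftrightarrow> ?H `` {z} = ?H `` {w}" if "z \<in> ?I" "w \<in> ?I" for z w
    proof -
      have "z \<in> A" "w \<in> A"
        using that I by auto
      moreover from this have "F z \<in> Field r" "F w \<in> Field r" "z \<in> Field r" "w \<in> Field r"
        using F AB by (auto simp: bij_betw_def)
      ultimately show ?thesis
        by (simp add: less.IH[OF \<open>\<beta> < \<gamma>\<close>] eq_equiv_class_iff[OF e])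
    qed
    have "finite ((\<lambda>z. ?H `` {F z}) ` ?I) \<longleftrightarrow> finite ((\<lambda>z. ?H `` {z}) ` ?I)"
      using finite_image_transfer[of "\<lambda>z. ?H `` {F z}" ?I "\<lambda>z. ?H `` {z}"]
        finite_image_transfer[of "\<lambda>z. ?H `` {z}" ?I "\<lambda>z. ?H `` {F z}"] cl by blast
    then have "finite ((\<lambda>z. ?H `` {z}) ` order_interval r (F x) (F y)) \<longleftrightarrow>
        finite ((\<lambda>z. ?H `` {z}) ` ?I)"
      unfolding iso_Restr_image_order_interval[OF r A B iso less.prems, symmetric] image_image .
    then show ?thesis
      using fld by (simp add: hausdorff_rel_successor_iff[OF successor e])
  next
    case (limit \<alpha>)
    have "(F x, F y) \<in> hausdorff_rel r \<beta> \<longleftrightarrow> (x, y) \<in> hausdorff_rel r \<beta>" if "\<beta> \<in> {..<\<gamma>}" for \<beta>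
      by (rule less.IH) (use that less.prems in simp_all)
    then show ?thesis
      unfolding hausdorff_rel_limit[OF limit] by simp
  qed
qed

section \<open>Cuts through a class\<close>

lemma finite_Linear_order_has_last:
  assumes "Linear_order r" "finite T" "T \<noteq> {}" "T \<subseteq> Field r"
  shows "\<exists>m\<in>T. \<forall>t\<in>T. (t, m) \<in> r"
  using assms(2-4)
proof (induction rule: finite_ne_induct)
  case (singleton x)
  then show ?case
    using Linear_orderD(1)[OF assms(1)] by blast
next
  case (insert x T)
  then obtain m where m: "m \<in> T" "\<forall>t\<in>T. (t, m) \<in> r"
    by blast
  have "m \<in> Field r" "x \<in> Field r"
    using m insert.prems by auto
  then consider "(x, m) \<in> r" | "(m, x) \<in> r" "(x, x) \<in> r"
    using Linear_orderD(1,4)[OF assms(1)] by blast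
  then show ?case
  proof cases
    case 1
    then show ?thesis
      using m by blast
  next
    case 2
    then have "\<forall>t\<in>insert x T. (t, x) \<in> r"
      using m Linear_orderD(2)[OF assms(1)] by blast
    then show ?thesis
      by blast
  qed
qed

text \<open>Membership in \<open>r \<union> H\<close> expresses that the class of \<open>x\<close>
  is at most that of \<open>m\<close>. From \<open>a\<close> upwards \<open>A\<close> meets only
  finitely many classes, and \<open>m\<close> is the largest of finitely many points representing
  them.\<close>

lemma initial_part_has_last_class:
  assumes r: "Linear_order r" and H: "convex_equiv r H"
    and A: "A \<subseteq> Field r" "\<And>x y. y \<in> A \<Longrightarrow> (x, y) \<in> r \<Longrightarrow> x \<in> A"
    and "a \<in> A" "b \<in> Field r - A"
    and fin: "finite ((\<lambda>z. H `` {z}) ` order_interval r a b)"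
  shows "\<exists>m\<in>A. \<forall>x\<in>A. (x, m) \<in> r \<union> H"
proof -
  let ?S = "order_interval r a b \<inter> A"
  have b: "(x, b) \<in> r" if "x \<in> A" for x
  proof -
    have "(b, x) \<notin> r"
      using that assms(6) A(2) by blast
    then show ?thesis
      using that assms(6) A(1) Linear_orderD(4)[OF r, of x b] by blast
  qed
  \<comment> \<open>All of \<open>A\<close> lies below \<open>b\<close>, so \<open>?S\<close> is the
    final segment of \<open>A\<close> starting at \<open>a\<close>, and its last class is the last
    class of \<open>A\<close>.\<close>
  have S: "z \<in> ?S \<longleftrightarrow> z \<in> A \<and> (a, z) \<in> r" for z
    unfolding order_interval_eq[OF r b[OF assms(5)]] using b by blast
  have "finite ((\<lambda>z. H `` {z}) ` ?S)"
    by (rule finite_subset[OF _ fin]) blast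
  then obtain T where T: "T \<subseteq> ?S" "finite T" "(\<lambda>z. H `` {z}) ` ?S = (\<lambda>z. H `` {z}) ` T"
    using finite_subset_image[OF _ subset_refl, of "\<lambda>z. H `` {z}" ?S] by blast
  have "a \<in> ?S"
    using S assms(5) A(1) Linear_orderD(1)[OF r] by blast
  then have "T \<noteq> {}"
    using T(3) by blast
  moreover have "T \<subseteq> Field r"
    using T(1) A(1) by blast
  ultimately obtain m where m: "m \<in> T" "\<forall>t\<in>T. (t, m) \<in> r"
    using finite_Linear_order_has_last[OF r T(2)] by blast
  have mA: "m \<in> A" "(a, m) \<in> r"
    using m(1) T(1) S by blast+
  moreover have "(x, m) \<in> r \<union> H" if "x \<in> A" for x
  proof (cases "(x, m) \<in> r")
    case False
    then have mx: "(m, x) \<in> r"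
      using that mA(1) A(1) Linear_orderD(4)[OF r] by blast
    then have "x \<in> ?S"
      using S that mA(2) Linear_orderD(2)[OF r] by blast
    then have "H `` {x} \<in> (\<lambda>z. H `` {z}) ` T"
      unfolding T(3)[symmetric] by (rule imageI)
    then obtain t where t: "t \<in> T" "H `` {x} = H `` {t}"
      by (rule imageE)
    \<comment> \<open>Now \<open>t \<le> m \<le> x\<close> with \<open>x\<close> and
      \<open>t\<close> equivalent, so convexity makes \<open>m\<close> equivalent to them.\<close>
    have "(x, t) \<in> H"
      using eq_equiv_class[OF t(2) convex_equivD(1)[OF H]] t(1) \<open>T \<subseteq> Field r\<close> by (meson subsetD)
    moreover have "m \<in> order_interval r x t"
      using m(2) t(1) mx unfolding order_interval_def by blast
    ultimately show ?thesis
      using convex_equivD(6)[OF H] by blast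
  qed simp
  ultimately show ?thesis
    by blast
qed

section \<open>Partitions that separate equivalent points\<close>

lemma order_partitionD:
  assumes "Linear_order r" "order_partition r A B"
  shows "A \<subseteq> Field r" "B \<subseteq> Field r" "A \<union> B = Field r" "A \<inter> B = {}"
    and "\<And>x y. y \<in> A \<Longrightarrow> (x, y) \<in> r \<Longrightarrow> x \<in> A"
    and "\<And>x y. x \<in> B \<Longrightarrow> (x, y) \<in> r \<Longrightarrow> y \<in> B"
    and "\<And>x y. x \<in> A \<Longrightarrow> y \<in> B \<Longrightarrow> (x, y) \<in> r"
    and "order_convex r A" "order_convex r B"
proof -
  show 1: "A \<subseteq> Field r" "B \<subseteq> Field r" "A \<union> B = Field r" "A \<inter> B = {}"
    using assms(2) unfolding order_partition_def ofilter_def by auto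
  show 2: "x \<in> A" if "y \<in> A" "(x, y) \<in> r" for x y
    using that assms(2) unfolding order_partition_def ofilter_def under_def by blast
  show 3: "y \<in> B" if "x \<in> B" "(x, y) \<in> r" for x y
  proof -
    have "y \<notin> A" "y \<in> Field r"
      using 1(4) 2[OF _ that(2)] that(1) FieldI2[OF that(2)] by blast+
    then show ?thesis
      using 1(3) by blast
  qed
  show "(x, y) \<in> r" if "x \<in> A" "y \<in> B" for x y
  proof -
    have "(y, x) \<notin> r"
      using 1(4) 2[OF that(1), of y] that(2) by blast
    then show ?thesis
      using that 1(1,2) Linear_orderD(4)[OF assms(1), of x y] by blast
  qed
  show "order_convex r A"
    unfolding order_convex_def order_interval_def using 1(1) by (auto dest: 2)
  show "order_convex r B"
    unfolding order_convex_def order_interval_def using 1(2) by (auto dest: 3)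
qed

text \<open>The interval from \<open>a\<close> to \<open>b\<close> crosses the cut and meets
  finitely many classes at some level \<open>\<beta> < \<gamma>\<close>. Hence, at this one level,
  the classes met on either side cannot accumulate at the cut.\<close>

lemma cut_through_class:
  fixes \<gamma> :: "'o::wellorder"
  assumes r: "Linear_order r" and AB: "order_partition r A B"
    and ab: "a \<in> A" "b \<in> B" "(a, b) \<in> hausdorff_rel r \<gamma>"
  obtains \<beta> m n where "\<beta> < \<gamma>"
    "m \<in> A" "\<And>x. x \<in> A \<Longrightarrow> (x, m) \<in> r \<union> hausdorff_rel r \<beta>"
    "n \<in> B" "\<And>x. x \<in> B \<Longrightarrow> (n, x) \<in> r \<union> hausdorff_rel r \<beta>"
proof -
  note part = order_partitionD[OF r AB]
  have "a \<noteq> b"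
    using ab part(4) by blast
  then obtain \<beta> where \<beta>: "\<beta> < \<gamma>" "finite ((\<lambda>z. hausdorff_rel r \<beta> `` {z}) ` order_interval r a b)"
    by (rule hausdorff_rel_distinctD[OF r ab(3)])
  let ?H = "hausdorff_rel r \<beta>"
  have H: "convex_equiv r ?H"
    by (rule hausdorff_rel_convex_equiv[OF r])
  have "\<exists>m\<in>A. \<forall>x\<in>A. (x, m) \<in> r \<union> ?H"
  proof (rule initial_part_has_last_class[OF r H part(1) _ ab(1) _ \<beta>(2)])
    show "b \<in> Field r - A"
      using ab(2) part(2,4) by blast
  qed (rule part(5))
  then obtain m where m: "m \<in> A" "\<And>x. x \<in> A \<Longrightarrow> (x, m) \<in> r \<union> ?H"
    by blast
  \<comment> \<open>In the reversed order \<open>B\<close> is an initial segment and its first class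
    becomes the last. The lemma accepts any convex equivalence, so \<open>?H\<close> remains the
    relation computed from \<open>r\<close>.\<close>
  have "\<exists>n\<in>B. \<forall>x\<in>B. (x, n) \<in> r\<inverse> \<union> ?H"
  proof (rule initial_part_has_last_class[of "r\<inverse>" ?H B b a])
    show "Linear_order (r\<inverse>)"
      using r by simp
    show "finite ((\<lambda>z. ?H `` {z}) ` order_interval (r\<inverse>) b a)"
      using \<beta>(2) by (simp add: order_interval_converse order_interval_commute)
    show "x \<in> B" if "y \<in> B" "(x, y) \<in> r\<inverse>" for x y
      using part(6) that by simp
  qed (use H part(1,2,4) ab(1,2) in \<open>auto simp: convex_equiv_converse\<close>)
  then obtain n where n: "n \<in> B" "\<And>x. x \<in> B \<Longrightarrow> (x, n) \<in> r\<inverse> \<union> ?H"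
    by blast
  have "(n, x) \<in> r \<union> ?H" if "x \<in> B" for x
    using n(2)[OF that] convex_equivD(3)[OF H] by blast
  with \<beta>(1) m n(1) show ?thesis
    by (rule that)
qed

section \<open>Endpoints of the condensation\<close>

lemma hausdorff_condensation_refl:
  fixes \<gamma> :: "'o::wellorder"
  assumes "Linear_order r" "C \<in> Field r // hausdorff_rel r \<gamma>"
  shows "(C, C) \<in> hausdorff_condensation r \<gamma>"
proof -
  obtain x where "x \<in> Field r" "C = hausdorff_rel r \<gamma> `` {x}"
    using assms(2) by (rule quotientE)
  then show ?thesis
    using assms(2) Linear_orderD(1)[OF assms(1)]
      convex_equivD(2)[OF hausdorff_rel_convex_equiv[OF assms(1)]]
    unfolding hausdorff_condensation_def by blast
qed

lemma Field_hausdorff_condensation: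
  fixes \<gamma> :: "'o::wellorder"
  assumes "Linear_order r"
  shows "Field (hausdorff_condensation r \<gamma>) = Field r // hausdorff_rel r \<gamma>"
  using hausdorff_condensation_refl[OF assms, of _ \<gamma>]
  unfolding Field_def hausdorff_condensation_def by blast

lemma bounded_hausdorff_condensation:
  fixes \<beta> :: "'o::wellorder"
  assumes r: "Linear_order r"
    and m: "m \<in> Field r" "\<And>x. x \<in> Field r \<Longrightarrow> (x, m) \<in> r \<union> hausdorff_rel r \<beta>"
    and n: "n \<in> Field r" "\<And>x. x \<in> Field r \<Longrightarrow> (n, x) \<in> r \<union> hausdorff_rel r \<beta>"
  shows "bounded_order (hausdorff_condensation r \<beta>)"
proof -
  let ?H = "hausdorff_rel r \<beta>"
  let ?Q = "hausdorff_condensation r \<beta>"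
  note H = convex_equivD[OF hausdorff_rel_convex_equiv[OF r, of \<beta>]]
  have Q: "(?H `` {x}, ?H `` {y}) \<in> ?Q" if "x \<in> Field r" "y \<in> Field r" "(x, y) \<in> r \<union> ?H" for x y
  proof -
    \<comment> \<open>If \<open>x\<close> and \<open>y\<close> are merely equivalent, then
      \<open>x\<close> lies in both classes and the reflexive pair \<open>(x, x)\<close> witnesses
      the comparison.\<close>
    have "(x, y) \<in> r \<or> (x, x) \<in> r \<and> x \<in> ?H `` {y}"
      using that H(3) Linear_orderD(1)[OF r] by blast
    moreover have "x \<in> ?H `` {x}" "y \<in> ?H `` {y}"
      using that H(2) by blast+
    moreover have "?H `` {x} \<in> Field r // ?H" "?H `` {y} \<in> Field r // ?H"
      using that by (auto intro: quotientI)
    ultimately show ?thesis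
      unfolding hausdorff_condensation_def by blast
  qed
  show ?thesis
    unfolding bounded_order_def Field_hausdorff_condensation[OF r]
    by (intro conjI bexI[of _ "?H `` {m}"] bexI[of _ "?H `` {n}"])
      (use m n Q in \<open>auto intro: quotientI elim!: quotientE\<close>)
qed

text \<open>The lower part \<open>A\<close> is moved to the upper part \<open>A'\<close>, so a last
  class of \<open>A\<close> becomes last in the whole order; likewise a first class of
  \<open>B\<close> becomes first. A class split by the cut would give both at the same level
  \<open>\<beta> < \<gamma>\<close>, against \<open>unb\<close>.\<close>

lemma cut_saturated:
  fixes \<gamma> :: "'o::wellorder"
  assumes r: "Linear_order r"
    and AB: "order_partition r A B" and BA: "order_partition r B' A'"
    and F: "iso (Restr r A) (Restr r A') F" and G: "iso (Restr r B) (Restr r B') G"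
    and unb: "\<forall>\<beta><\<gamma>. \<not> bounded_order (hausdorff_condensation r \<beta>)"
  shows "A \<times> B \<inter> hausdorff_rel r \<gamma> = {}"
proof (rule ccontr)
  assume "A \<times> B \<inter> hausdorff_rel r \<gamma> \<noteq> {}"
  then obtain a b where ab: "a \<in> A" "b \<in> B" "(a, b) \<in> hausdorff_rel r \<gamma>"
    by blast
  obtain \<beta> m n where \<beta>: "\<beta> < \<gamma>"
    and m: "m \<in> A" "\<And>x. x \<in> A \<Longrightarrow> (x, m) \<in> r \<union> hausdorff_rel r \<beta>"
    and n: "n \<in> B" "\<And>x. x \<in> B \<Longrightarrow> (n, x) \<in> r \<union> hausdorff_rel r \<beta>"
    by (rule cut_through_class[OF r AB ab]) blast
  let ?H = "hausdorff_rel r \<beta>"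
  note p = order_partitionD[OF r AB] and p' = order_partitionD[OF r BA]
  have F': "bij_betw F A A'" "\<And>x y. x \<in> A \<Longrightarrow> y \<in> A \<Longrightarrow> (x, y) \<in> r \<longleftrightarrow> (F x, F y) \<in> r"
    using F unfolding iso_Restr_iff[OF r p(1) p'(2)] by auto
  have G': "bij_betw G B B'" "\<And>x y. x \<in> B \<Longrightarrow> y \<in> B \<Longrightarrow> (x, y) \<in> r \<longleftrightarrow> (G x, G y) \<in> r"
    using G unfolding iso_Restr_iff[OF r p(2) p'(1)] by auto
  have Fm: "F m \<in> A'" and Gn: "G n \<in> B'"
    using m(1) n(1) F'(1) G'(1) by (auto simp: bij_betw_apply)
  have "bounded_order (hausdorff_condensation r \<beta>)"
  proof (rule bounded_hausdorff_condensation[OF r])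
    show "F m \<in> Field r" "G n \<in> Field r"
      using Fm Gn p' by blast+
    show "(y, F m) \<in> r \<union> ?H" if "y \<in> Field r" for y
    proof (cases "y \<in> A'")
      case True
      then obtain x where "x \<in> A" "y = F x"
        using F'(1) by (metis bij_betw_imp_surj_on imageE)
      then show ?thesis
        using m F'(2) hausdorff_rel_iso_Restr_iff[OF r p(8) p'(9) F] by blast
    next
      case False
      then show ?thesis
        using that Fm p'(3,7) by blast
    qed
    show "(G n, y) \<in> r \<union> ?H" if "y \<in> Field r" for y
    proof (cases "y \<in> B'")
      case True
      then obtain x where "x \<in> B" "y = G x"
        using G'(1) by (metis bij_betw_imp_surj_on imageE)
      then show ?thesis
        using n G'(2) hausdorff_rel_iso_Restr_iff[OF r p(9) p'(8) G] by blast
    next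
      case False
      then show ?thesis
        using that Gn p'(3,7) by blast
    qed
  qed
  then show False
    using unb \<beta> by blast
qed

section \<open>Descending to the condensation\<close>

text \<open>By symmetry any equivalent pair across the cut can be read from \<open>A\<close> to
  \<open>B\<close>, which \<open>sat\<close> forbids. So each part is a union of classes.\<close>

lemma hausdorff_rel_Image_part:
  fixes \<gamma> :: "'o::wellorder"
  assumes r: "Linear_order r" and AB: "order_partition r A B"
    and sat: "A \<times> B \<inter> hausdorff_rel r \<gamma> = {}"
  shows "hausdorff_rel r \<gamma> `` A \<subseteq> A" and "hausdorff_rel r \<gamma> `` B \<subseteq> B"
proof -
  note p = order_partitionD[OF r AB]
  note H = convex_equivD[OF hausdorff_rel_convex_equiv[OF r, of \<gamma>]]
  show "hausdorff_rel r \<gamma> `` A \<subseteq> A"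
  proof (rule subsetI, erule ImageE)
    fix x y assume "(x, y) \<in> hausdorff_rel r \<gamma>" "x \<in> A"
    then show "y \<in> A"
      using sat H(5)[of x y] p(3) by blast
  qed
  show "hausdorff_rel r \<gamma> `` B \<subseteq> B"
  proof (rule subsetI, erule ImageE)
    fix x y assume "(x, y) \<in> hausdorff_rel r \<gamma>" "x \<in> B"
    then show "y \<in> B"
      using sat H(3)[of x y] H(5)[of x y] p(3) by blast
  qed
qed

lemma order_partition_hausdorff_condensation:
  fixes \<gamma> :: "'o::wellorder"
  assumes r: "Linear_order r" and AB: "order_partition r A B"
    and sat: "A \<times> B \<inter> hausdorff_rel r \<gamma> = {}"
  shows "order_partition (hausdorff_condensation r \<gamma>)
           (A // hausdorff_rel r \<gamma>) (B // hausdorff_rel r \<gamma>)"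
proof -
  let ?H = "hausdorff_rel r \<gamma>"
  let ?Q = "hausdorff_condensation r \<gamma>"
  note p = order_partitionD[OF r AB]
  note H = convex_equivD[OF hausdorff_rel_convex_equiv[OF r, of \<gamma>]]
  have un: "Field r // ?H = A // ?H \<union> B // ?H"
    unfolding p(3)[symmetric] quotient_def by blast
  have A_sat: "C \<subseteq> A" if "C \<in> A // ?H" for C
    using that hausdorff_rel_Image_part(1)[OF r AB sat] by (auto elim!: quotientE)
  \<comment> \<open>Any point of a class represents it, so a class meeting \<open>A\<close> belongs
    to \<open>A // ?H\<close>. This makes \<open>A // ?H\<close> downward closed.\<close>
  have A_class: "C \<in> A // ?H" if C: "C \<in> Field r // ?H" "x \<in> C" "x \<in> A" for C x
  proof -
    have "C = ?H `` {x}"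
      using C(1,2) H(1) by (metis Image_singleton_iff equiv_class_eq quotientE)
    then show ?thesis
      using C(3) by (simp add: quotientI)
  qed
  have disj: "A // ?H \<inter> B // ?H = {}"
  proof -
    have "C \<notin> B // ?H" if "C \<in> A // ?H" for C
    proof
      assume "C \<in> B // ?H"
      then obtain b where "b \<in> B" "C = ?H `` {b}"
        by (rule quotientE)
      then have "b \<in> C"
        using H(2) p(2) by blast
      then show False
        using A_sat[OF that] \<open>b \<in> B\<close> p(4) by blast
    qed
    then show ?thesis
      by blast
  qed
  have "under ?Q C \<subseteq> A // ?H" if C: "C \<in> A // ?H" for C
  proof
    fix D assume "D \<in> under ?Q C"
    then obtain x y where "D \<in> Field r // ?H" "x \<in> D" "y \<in> C" "(x, y) \<in> r"
      unfolding under_def hausdorff_condensation_def by blast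
    then show "D \<in> A // ?H"
      using A_class A_sat[OF C] p(5) by blast
  qed
  then show ?thesis
    unfolding order_partition_def ofilter_def Field_hausdorff_condensation[OF r]
    using un disj by blast
qed

text \<open>Closure under the relation makes \<open>F\<close> carry whole classes onto whole
  classes: \<open>satA\<close> keeps the class of \<open>x\<close> within the domain, and
  \<open>satB\<close> lets every point of the class of \<open>F x\<close> be pulled back. Direct
  image is then the induced map.\<close>

lemma iso_hausdorff_condensation:
  fixes \<gamma> :: "'o::wellorder"
  assumes r: "Linear_order r" and A: "order_convex r A" and B: "order_convex r B"
    and iso: "iso (Restr r A) (Restr r B) F"
    and satA: "hausdorff_rel r \<gamma> `` A \<subseteq> A" and satB: "hausdorff_rel r \<gamma> `` B \<subseteq> B"
  shows "iso (Restr (hausdorff_condensation r \<gamma>) (A // hausdorff_rel r \<gamma>))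
             (Restr (hausdorff_condensation r \<gamma>) (B // hausdorff_rel r \<gamma>)) ((`) F)"
    and "\<And>x. x \<in> A \<Longrightarrow> F ` (hausdorff_rel r \<gamma> `` {x}) = hausdorff_rel r \<gamma> `` {F x}"
proof -
  let ?H = "hausdorff_rel r \<gamma>"
  let ?Q = "hausdorff_condensation r \<gamma>"
  have AB: "A \<subseteq> Field r" "B \<subseteq> Field r"
    using A B unfolding order_convex_def by auto
  have F: "bij_betw F A B" "\<And>x y. x \<in> A \<Longrightarrow> y \<in> A \<Longrightarrow> (x, y) \<in> r \<longleftrightarrow> (F x, F y) \<in> r"
    using iso unfolding iso_Restr_iff[OF r AB] by auto
  have FH: "(F x, F y) \<in> ?H \<longleftrightarrow> (x, y) \<in> ?H" if "x \<in> A" "y \<in> A" for x y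
    by (rule hausdorff_rel_iso_Restr_iff[OF r A B iso that])
  show cl: "F ` (?H `` {x}) = ?H `` {F x}" if x: "x \<in> A" for x
  proof
    show "F ` (?H `` {x}) \<subseteq> ?H `` {F x}"
    proof (rule image_subsetI)
      fix y assume "y \<in> ?H `` {x}"
      moreover from this have "y \<in> A"
        using satA x by blast
      ultimately show "F y \<in> ?H `` {F x}"
        using FH[OF x] by simp
    qed
    show "?H `` {F x} \<subseteq> F ` (?H `` {x})"
    proof
      fix w assume w: "w \<in> ?H `` {F x}"
      then have "w \<in> B"
        using satB bij_betw_apply[OF F(1) x] by blast
      then obtain z where "z \<in> A" "w = F z"
        using F(1) by (metis bij_betw_imp_surj_on imageE)
      then show "w \<in> F ` (?H `` {x})"
        using w FH[OF x \<open>z \<in> A\<close>] by blast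
    qed
  qed
  have sub: "C \<subseteq> A" if "C \<in> A // ?H" for C
    using that satA by (auto elim!: quotientE)
  have im: "(`) F ` (A // ?H) = B // ?H"
  proof -
    have "(`) F ` (A // ?H) = (\<lambda>x. F ` (?H `` {x})) ` A"
      unfolding quotient_def by blast
    also have "\<dots> = (\<lambda>x. ?H `` {F x}) ` A"
      using cl by (rule image_cong[OF refl])
    also have "\<dots> = (\<lambda>y. ?H `` {y}) ` F ` A"
      by (simp add: image_image)
    also have "\<dots> = B // ?H"
      unfolding bij_betw_imp_surj_on[OF F(1)] quotient_def by blast
    finally show ?thesis .
  qed
  have image_class: "F ` C \<in> B // ?H" if "C \<in> A // ?H" for C
    unfolding im[symmetric] using that by (rule imageI)
  have "inj_on ((`) F) (A // ?H)"
    by (rule inj_on_subset[OF inj_on_image_Pow[OF bij_betw_imp_inj_on[OF F(1)]]])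
      (use sub in blast)
  then have bij: "bij_betw ((`) F) (A // ?H) (B // ?H)"
    using im by (simp add: bij_betw_def)
  have qsub: "A // ?H \<subseteq> Field r // ?H" "B // ?H \<subseteq> Field r // ?H"
    using AB unfolding quotient_def by blast+
  have fld: "Field (Restr ?Q S) = S" if "S \<subseteq> Field r // ?H" for S
  proof
    show "Field (Restr ?Q S) \<subseteq> S"
      unfolding Field_def by blast
    show "S \<subseteq> Field (Restr ?Q S)"
    proof
      fix C assume "C \<in> S"
      then have "(C, C) \<in> Restr ?Q S"
        using hausdorff_condensation_refl[OF r] that by blast
      then show "C \<in> Field (Restr ?Q S)"
        by (rule FieldI1)
    qed
  qed
  have ord: "(C, D) \<in> ?Q \<longleftrightarrow> (F ` C, F ` D) \<in> ?Q" if CD: "C \<in> A // ?H" "D \<in> A // ?H" for C D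
  proof -
    have "F ` C \<in> Field r // ?H" "F ` D \<in> Field r // ?H"
      by (intro subsetD[OF qsub(2)] image_class CD)+
    moreover have "C \<in> Field r // ?H" "D \<in> Field r // ?H"
      by (intro subsetD[OF qsub(1)] CD)+
    moreover have "(\<exists>u\<in>F ` C. \<exists>v\<in>F ` D. (u, v) \<in> r) \<longleftrightarrow> (\<exists>x\<in>C. \<exists>y\<in>D. (F x, F y) \<in> r)"
      by blast
    \<comment> \<open>The points of \<open>C\<close> and \<open>D\<close> lie in \<open>A\<close>,
      where \<open>F\<close> preserves and reflects \<open>r\<close>.\<close>
    moreover have "\<dots> \<longleftrightarrow> (\<exists>x\<in>C. \<exists>y\<in>D. (x, y) \<in> r)"
      by (rule bex_cong[OF refl], rule bex_cong[OF refl], rule F(2)[symmetric])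
        (use sub CD in blast)+
    ultimately show ?thesis
      unfolding hausdorff_condensation_def mem_Collect_eq case_prod_conv by metis
  qed
  show "iso (Restr ?Q (A // ?H)) (Restr ?Q (B // ?H)) ((`) F)"
    unfolding iso_iff2 fld[OF qsub(1)] fld[OF qsub(2)]
  proof (intro conjI ballI bij)
    fix C D assume CD: "C \<in> A // ?H" "D \<in> A // ?H"
    then show "(C, D) \<in> Restr ?Q (A // ?H) \<longleftrightarrow> (F ` C, F ` D) \<in> Restr ?Q (B // ?H)"
      using ord[OF CD] image_class by simp
  qed
qed

theorem theorem4p15:
  fixes r :: "'a rel" and \<gamma> :: "'o::wellorder"
  assumes "Linear_order r"
    and "cyclically_transitive r"
    and "\<not> bounded_order r"
    and "\<forall>\<beta><\<gamma>. \<not> bounded_order (hausdorff_condensation r \<beta>)"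
  shows "cyclically_transitive (hausdorff_condensation r \<gamma>)"
  unfolding cyclically_transitive_def
proof (intro allI impI)
  note r = assms(1)
  let ?H = "hausdorff_rel r \<gamma>"
  let ?Q = "hausdorff_condensation r \<gamma>"
  note H = convex_equivD[OF hausdorff_rel_convex_equiv[OF r, of \<gamma>]]
  fix C D assume "(C, D) \<in> ?Q"
  then obtain a b where ab: "C \<in> Field r // ?H" "D \<in> Field r // ?H" "a \<in> C" "b \<in> D" "(a, b) \<in> r"
    unfolding hausdorff_condensation_def by blast
  then have CD: "C = ?H `` {a}" "D = ?H `` {b}"
    using H(1) by (metis Image_singleton_iff equiv_class_eq quotientE)+
  \<comment> \<open>Cyclic transitivity is applied to the representatives that witness that
    \<open>C\<close> is at most \<open>D\<close>.\<close>
  from assms(2) ab(5) obtain L1 L2 L1' L2' F1 F2 where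
    L: "order_partition r L1 L2" and L': "order_partition r L2' L1'"
    and "a \<in> L1" "b \<in> L1'"
    and F1: "iso (Restr r L1) (Restr r L1') F1" and F2: "iso (Restr r L2) (Restr r L2') F2"
    and "F1 a = b"
    unfolding cyclically_transitive_def by metis
  note p = order_partitionD[OF r L] and p' = order_partitionD[OF r L']
  have sat: "L1 \<times> L2 \<inter> ?H = {}"
    by (rule cut_saturated[OF r L L' F1 F2 assms(4)])
  \<comment> \<open>The same lemma with the two partitions exchanged: the inverse of
    \<open>F2\<close> takes the lower part \<open>L2'\<close> to the upper part \<open>L2\<close>,
    and the inverse of \<open>F1\<close> takes \<open>L1'\<close> down to \<open>L1\<close>.\<close>
  have sat': "L2' \<times> L1' \<inter> ?H = {}"
    by (rule cut_saturated[OF r L' L iso_Restr_inv[OF r p(2) p'(1) F2]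
          iso_Restr_inv[OF r p(1) p'(2) F1] assms(4)])
  note closed = hausdorff_rel_Image_part[OF r L sat] hausdorff_rel_Image_part[OF r L' sat']
  have "order_partition ?Q (L1 // ?H) (L2 // ?H)" "order_partition ?Q (L2' // ?H) (L1' // ?H)"
    by (rule order_partition_hausdorff_condensation[OF r L sat])
      (rule order_partition_hausdorff_condensation[OF r L' sat'])
  moreover have "C \<in> L1 // ?H" "D \<in> L1' // ?H"
    using \<open>a \<in> L1\<close> \<open>b \<in> L1'\<close> CD by (auto intro: quotientI)
  moreover have "iso (Restr ?Q (L1 // ?H)) (Restr ?Q (L1' // ?H)) ((`) F1)"
    "iso (Restr ?Q (L2 // ?H)) (Restr ?Q (L2' // ?H)) ((`) F2)"
    by (rule iso_hausdorff_condensation(1)[OF r p(8) p'(9) F1 closed(1,4)])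
      (rule iso_hausdorff_condensation(1)[OF r p(9) p'(8) F2 closed(2,3)])
  moreover have "F1 ` C = D"
    using iso_hausdorff_condensation(2)[OF r p(8) p'(9) F1 closed(1,4) \<open>a \<in> L1\<close>]
    by (simp add: CD \<open>F1 a = b\<close>)
  ultimately show "\<exists>L1 L2 L1' L2' F1 F2.
      order_partition ?Q L1 L2 \<and> order_partition ?Q L2' L1' \<and> C \<in> L1 \<and> D \<in> L1' \<and>
      iso (Restr ?Q L1) (Restr ?Q L1') F1 \<and> iso (Restr ?Q L2) (Restr ?Q L2') F2 \<and> F1 C = D"
    by (intro exI conjI)
qed

end
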